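(* Let $2\le k\le n$ be integers and let $Y$ be a graph on $n$ vertices. Then the following are equivalent: (i) the friends-and-strangers graph $\mathsf{FS}(\mathsf{Lollipop}_{n-k,k},Y)$ is connected; (ii) every induced subgraph of $Y$ with exactly $k$ vertices is connected; (iii) $Y$ is $(n-k+1)$-connected.
   Context: All graphs are finite and simple (no loops, no multiple edges). Friends-and-strangers graph: for two graphs $X$ and $Y$, each with $n$ vertices, $\mathsf{FS}(X,Y)$ is the graph whose vertices are all bijections $\sigma:V(X)\to V(Y)$, where two bijections $\sigma,\sigma'$ are adjacent if and only if there is an edge $\{a,b\}\in E(X)$ such that $\{\sigma(a),\sigma(b)\}\in E(Y)$, $\sigma(a)=\sigma'(b)$, $\sigma(b)=\sigma'(a)$, and $\sigma(c)=\sigma'(c)$ for all $c\in V(X)\setminus\{a,b\}$. Lollipop graph: $\mathsf{Lollipop}_{n-k,k}$ is the graph of order $n$ obtained by identifying one end of a path with $n-k+1$ vertices with a vertex of a complete graph on $k$ vertices. Concretely, it has vertex set $\{1,\dots,n\}$, with edges $\{i,i+1\}$ for $1\le i\le n-k$ together with all edges $\{i,j\}$ with $n-k+1\le i<j\le n$. (For $k=n$ it is the complete graph on $n$ vertices.) Connectivity convention: a graph $G$ is $\ell$-connected if the graph obtained by removing any $\ell-1$ vertices from $G$ is still connected. *)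

theory Defs
  imports "Graph_Theory.Digraph_Component" "HOL-Library.FuncSet"
begin

text \<open>
  A finite simple graph is a \<open>pair_graph\<close>: a finite, loop-free, symmetric set of pairs of
  vertices, the undirected edge \<open>{a, b}\<close> being the two arcs \<open>(a, b)\<close> and \<open>(b, a)\<close>.
\<close>

text \<open>
  A map \<open>V(X) \<rightarrow> V(Y)\<close> is a total function that is \<open>undefined\<close> outside \<open>V(X)\<close>, so that
  every bijection is represented by exactly one vertex.
\<close>

definition FS :: "'a pair_pre_digraph \<Rightarrow> 'b pair_pre_digraph \<Rightarrow> ('a \<Rightarrow> 'b) pair_pre_digraph" where
  "FS X Y =
    (let B = {\<sigma> \<in> extensional (pverts X). bij_betw \<sigma> (pverts X) (pverts Y)} in
     \<lparr> pverts = B,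
       parcs = {(\<sigma>, \<sigma>'). \<sigma> \<in> B \<and> \<sigma>' \<in> B \<and>
         (\<exists>a b. (a, b) \<in> parcs X \<and> (\<sigma> a, \<sigma> b) \<in> parcs Y \<and>
            \<sigma> a = \<sigma>' b \<and> \<sigma> b = \<sigma>' a \<and> (\<forall>c \<in> pverts X - {a, b}. \<sigma> c = \<sigma>' c))} \<rparr>)"

text \<open>
  The path is \<open>1, \<dots>, m + 1\<close> and the clique is \<open>{m + 1..m + k}\<close>; the order is \<open>m + k\<close>.
\<close>

definition lollipop :: "nat \<Rightarrow> nat \<Rightarrow> nat pair_pre_digraph" where
  "lollipop m k =
    (let E = {(i, i + 1) |i. 1 \<le> i \<and> i \<le> m} \<union>
             {(i, j). m + 1 \<le> i \<and> i < j \<and> j \<le> m + k} in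
     \<lparr> pverts = {1..m + k}, parcs = E \<union> E\<inverse> \<rparr>)"

text \<open>
  Exactly \<open>l - 1\<close> vertices are removed, and there is no lower bound on the order of the graph.
  The definition is meant for \<open>l \<ge> 1\<close> and finite graphs. As \<open>connected\<close> is false of the
  graph without vertices, a graph of order \<open>l - 1\<close> is not \<open>l\<close>-connected.
\<close>

definition vertex_connected :: "nat \<Rightarrow> 'a pair_pre_digraph \<Rightarrow> bool" where
  "vertex_connected l G \<longleftrightarrow>
    (\<forall>S \<subseteq> pverts G. card S = l - 1 \<longrightarrow>
      Digraph_Component.connected (with_proj G \<restriction> (pverts G - S)))"

lemma pair_graph_lollipop:
  assumes "k \<ge> 1"
  shows "pair_graph (lollipop m k)"
proof -
  have sub: "parcs (lollipop m k) \<subseteq> {1..m + k} \<times> {1..m + k}"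
    using assms by (auto simp: lollipop_def Let_def)
  have verts: "pverts (lollipop m k) = {1..m + k}"
    by (simp add: lollipop_def Let_def)
  have "finite (parcs (lollipop m k))"
    using sub by (rule finite_subset) simp
  moreover have "sym (parcs (lollipop m k))"
    by (simp add: lollipop_def Let_def sym_Un_converse)
  moreover have "fst e \<noteq> snd e" if "e \<in> parcs (lollipop m k)" for e
    using that by (auto simp: lollipop_def Let_def)
  ultimately show ?thesis
    using sub verts by unfold_locales (auto simp: symmetric_def)
qed

lemma pair_graph_FS:
  assumes "pair_graph X" "pair_graph Y"
  shows "pair_graph (FS X Y)"
proof -
  interpret X: pair_graph X by fact
  interpret Y: pair_graph Y by fact
  have symX: "(b, a) \<in> parcs X" if "(a, b) \<in> parcs X" for a b
    using X.pair_sym_arcs that unfolding symmetric_def by (simp add: symD)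
  have symY: "(b, a) \<in> parcs Y" if "(a, b) \<in> parcs Y" for a b
    using Y.pair_sym_arcs that unfolding symmetric_def by (simp add: symD)
  have "pverts (FS X Y) \<subseteq> pverts X \<rightarrow>\<^sub>E pverts Y"
    unfolding FS_def Let_def by (auto simp: PiE_def bij_betw_def)
  moreover have "finite (pverts X \<rightarrow>\<^sub>E pverts Y)"
    by (rule finite_PiE) (rule X.pair_finite_verts Y.pair_finite_verts)+
  ultimately have fin: "finite (pverts (FS X Y))"
    by (rule finite_subset)
  have sub: "parcs (FS X Y) \<subseteq> pverts (FS X Y) \<times> pverts (FS X Y)"
    unfolding FS_def Let_def by auto
  then have fin': "finite (parcs (FS X Y))"
    by (rule finite_subset) (simp add: fin)
  have E: "(s, t) \<in> parcs (FS X Y) \<longleftrightarrow> s \<in> pverts (FS X Y) \<and> t \<in> pverts (FS X Y) \<and>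
      (\<exists>a b. (a, b) \<in> parcs X \<and> (s a, s b) \<in> parcs Y \<and>
        s a = t b \<and> s b = t a \<and> (\<forall>c \<in> pverts X - {a, b}. s c = t c))" for s t
    unfolding FS_def Let_def by simp
  have sym: "(t, s) \<in> parcs (FS X Y)" if st: "(s, t) \<in> parcs (FS X Y)" for s t
  proof -
    from st[unfolded E] obtain a b where ab: "(a, b) \<in> parcs X" "(s a, s b) \<in> parcs Y"
      "s a = t b" "s b = t a" "\<forall>c \<in> pverts X - {a, b}. s c = t c"
      by blast
    have "(t a, t b) \<in> parcs Y"
      using symY[OF ab(2)] ab(3,4) by simp
    moreover have "\<forall>c \<in> pverts X - {a, b}. t c = s c"
      using ab(5) by simp
    ultimately have "\<exists>a b. (a, b) \<in> parcs X \<and> (t a, t b) \<in> parcs Y \<and>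
        t a = s b \<and> t b = s a \<and> (\<forall>c \<in> pverts X - {a, b}. t c = s c)"
      using ab(1) ab(3)[symmetric] ab(4)[symmetric] by blast
    with st show ?thesis unfolding E by blast
  qed
  have loop: "(s, s) \<notin> parcs (FS X Y)" for s
  proof
    assume "(s, s) \<in> parcs (FS X Y)"
    then obtain a b where "(s a, s b) \<in> parcs Y" "s a = s b"
      unfolding E by blast
    then show False using Y.pair_no_loops[of "(s a, s b)"] by simp
  qed
  have "sym (parcs (FS X Y))" using sym by (rule symI)
  then show ?thesis
    using sub fin fin' loop by unfold_locales (auto simp: symmetric_def)
qed

end

theory Submission
  imports Defs "HOL-Combinatorics.Permutations"
begin

text \<open>
  Necessity: let \<open>A\<close> be a set of \<open>k\<close> vertices of \<open>Y\<close>. By the pigeonhole principle the leftmost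
  position occupied by \<open>A\<close> always lies on the path, and if it is the vertex shared by path and
  clique, then the whole clique is occupied by \<open>A\<close>. Hence a move can change the leftmost member
  of \<open>A\<close> only by swapping it with a neighbour in \<open>A\<close>, and its component in \<open>Y[A]\<close> is an invariant.

  Sufficiency: peel off the end \<open>x\<close> of the path. The occupant of \<open>x\<close> can be exchanged for any of
  its neighbours in \<open>Y\<close>, by first arranging (inductively) that this neighbour stands next to \<open>x\<close>;
  walking through the connected graph \<open>Y\<close> brings the right occupant to \<open>x\<close>, and induction places
  the others. In the remaining complete graph, transpositions along a walk in \<open>Y\<close> generate all
  transpositions.
\<close>

section \<open>Induced subgraphs and reachability\<close>

definition pair_induce :: "'a pair_pre_digraph \<Rightarrow> 'a set \<Rightarrow> 'a pair_pre_digraph" where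
  "pair_induce G W = \<lparr> pverts = W, parcs = parcs G \<inter> W \<times> W \<rparr>"

text \<open>Stated with the plain closure of the arc relation, so that walks are handled by
  \<open>rtrancl\<close> induction. It holds vacuously for the graph without vertices, unlike
  \<open>connected\<close>.\<close>

definition linked :: "'a pair_pre_digraph \<Rightarrow> bool" where
  "linked G \<longleftrightarrow> (\<forall>u \<in> pverts G. \<forall>v \<in> pverts G. (u, v) \<in> (parcs G)\<^sup>*)"

lemma pair_induce_simps [simp]:
  "pverts (pair_induce G W) = W"
  "parcs (pair_induce G W) = parcs G \<inter> W \<times> W"
  by (simp_all add: pair_induce_def)

lemma with_proj_pair_induce: "with_proj (pair_induce G W) = with_proj G \<restriction> W"
  by (auto simp: with_proj_def pair_induce_def induce_subgraph_def)

lemma pair_induce_pair_induce: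
  "V \<subseteq> W \<Longrightarrow> pair_induce (pair_induce G W) V = pair_induce G V"
  by (auto simp: pair_induce_def)

lemma pair_graph_symD:
  "pair_graph G \<Longrightarrow> (a, b) \<in> parcs G \<Longrightarrow> (b, a) \<in> parcs G"
  using pair_sym_digraph.pair_sym_arcs[of G]
  by (auto simp: symmetric_def dest: symD
      intro: pair_graph.axioms pair_pseudo_graph.axioms)

lemma pair_graph_pair_induce:
  assumes "pair_graph G" "W \<subseteq> pverts G"
  shows "pair_graph (pair_induce G W)"
proof -
  interpret G: pair_graph G by fact
  have "finite W" using assms(2) G.pair_finite_verts by (rule finite_subset)
  moreover have "sym (parcs G \<inter> W \<times> W)"
    using pair_graph_symD[OF assms(1)] by (auto intro: symI)
  ultimately show ?thesis
    using G.pair_no_loops G.pair_finite_arcs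
    by unfold_locales (auto simp: symmetric_def)
qed

text \<open>\<open>connected\<close> asks for reachability in the symmetric closure and for a
  nonempty vertex set. The arcs are already symmetric, so nonemptiness is the only
  difference.\<close>

lemma connected_iff_linked:
  assumes "pair_graph G"
  shows "Digraph_Component.connected (with_proj G) \<longleftrightarrow> pverts G \<noteq> {} \<and> linked G"
proof -
  interpret G: pair_graph G by fact
  have *: "u \<rightarrow>\<^sup>*\<^bsub>with_proj G\<^esub> v \<longleftrightarrow> (u, v) \<in> (parcs G)\<^sup>*" if "u \<in> pverts G" for u v
  proof
    assume "u \<rightarrow>\<^sup>*\<^bsub>with_proj G\<^esub> v"
    then show "(u, v) \<in> (parcs G)\<^sup>*"
      by (auto simp: reachable_def dest: rtrancl_on_rtranclI)
  next
    assume "(u, v) \<in> (parcs G)\<^sup>*"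
    then show "u \<rightarrow>\<^sup>*\<^bsub>with_proj G\<^esub> v"
      by induction (use that in \<open>auto intro: G.reachable_adj_trans\<close>)
  qed
  show ?thesis
    by (auto simp: Digraph_Component.connected_def strongly_connected_def linked_def *
        G.reachable_mk_symmetric_eq G.sym_arcs)
qed

lemma rtrancl_image:
  assumes "(x, y) \<in> r\<^sup>*" "\<And>x y. (x, y) \<in> r \<Longrightarrow> (f x, f y) \<in> s"
  shows "(f x, f y) \<in> s\<^sup>*"
  using assms(1) by induction (auto intro: assms(2) rtrancl_into_rtrancl)

section \<open>Moves in friends-and-strangers graphs\<close>

lemma pverts_FS:
  "\<sigma> \<in> pverts (FS X Y) \<longleftrightarrow>
    \<sigma> \<in> extensional (pverts X) \<and> bij_betw \<sigma> (pverts X) (pverts Y)"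
  by (simp add: FS_def Let_def)

lemma parcs_FS:
  "(\<sigma>, \<sigma>') \<in> parcs (FS X Y) \<longleftrightarrow> \<sigma> \<in> pverts (FS X Y) \<and> \<sigma>' \<in> pverts (FS X Y) \<and>
    (\<exists>a b. (a, b) \<in> parcs X \<and> (\<sigma> a, \<sigma> b) \<in> parcs Y \<and>
      \<sigma> a = \<sigma>' b \<and> \<sigma> b = \<sigma>' a \<and> (\<forall>c \<in> pverts X - {a, b}. \<sigma> c = \<sigma>' c))"
  by (simp add: FS_def Let_def)

lemma FS_compose:
  assumes "\<sigma> \<in> pverts (FS X Y)" "p permutes pverts Y"
  shows "compose (pverts X) p \<sigma> \<in> pverts (FS X Y)"
  using assms by (auto simp: pverts_FS permutes_imp_bij intro: bij_betw_compose)

lemma FS_exists: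
  assumes "finite (pverts X)" "finite (pverts Y)" "card (pverts X) = card (pverts Y)"
    "x \<in> pverts X" "y \<in> pverts Y"
  obtains \<sigma> where "\<sigma> \<in> pverts (FS X Y)" "\<sigma> x = y"
proof -
  obtain f where f: "bij_betw f (pverts X) (pverts Y)"
    using finite_same_card_bij assms(1-3) by blast
  then have fx: "f x \<in> pverts Y" using assms(4) by (auto simp: bij_betw_def)
  have "restrict f (pverts X) \<in> pverts (FS X Y)"
    using f by (auto simp: pverts_FS cong: bij_betw_cong)
  from FS_compose[OF this permutes_swap_id[OF fx assms(5)]]
  show thesis by (rule that) (simp add: compose_def assms(4))
qed

text \<open>A move exchanges the contents of two positions. Writing it as a transposition of the
  occupants, composed on the left, turns sequences of moves into products of permutations of
  \<open>pverts Y\<close>.\<close>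

lemma FS_swap:
  assumes "pair_graph X" "\<sigma> \<in> pverts (FS X Y)" "(a, b) \<in> parcs X" "(\<sigma> a, \<sigma> b) \<in> parcs Y"
  shows "(\<sigma>, compose (pverts X) (transpose (\<sigma> a) (\<sigma> b)) \<sigma>) \<in> parcs (FS X Y)"
proof -
  interpret X: pair_graph X by fact
  have ab: "a \<in> pverts X" "b \<in> pverts X"
    using assms(3) X.arc_fst_in_verts X.arc_snd_in_verts by force+
  have bij: "bij_betw \<sigma> (pverts X) (pverts Y)" using assms(2) by (simp add: pverts_FS)
  then have "\<sigma> a \<in> pverts Y" "\<sigma> b \<in> pverts Y" using ab by (auto simp: bij_betw_def)
  then have "compose (pverts X) (transpose (\<sigma> a) (\<sigma> b)) \<sigma> \<in> pverts (FS X Y)"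
    by (intro FS_compose assms(2) permutes_swap_id)
  moreover have "\<sigma> c = transpose (\<sigma> a) (\<sigma> b) (\<sigma> c)" if "c \<in> pverts X - {a, b}" for c
    using that ab bij by (auto simp: bij_betw_def inj_on_eq_iff transpose_def)
  ultimately show ?thesis
    unfolding parcs_FS using assms(2-4) ab
    by (intro conjI exI[of _ a] exI[of _ b]) (auto simp: compose_def)
qed

section \<open>Complete graphs and generation by transpositions\<close>

lemma transpose_conj:
  "a \<noteq> z \<Longrightarrow> y \<noteq> z \<Longrightarrow> transpose a y \<circ> transpose y z \<circ> transpose a y = transpose a z"
  by (auto simp: transpose_def fun_eq_iff)

text \<open>Any two positions are adjacent, so every transposition of occupants adjacent in
  \<open>Y\<close> is a legal move from every state. Conjugating along walks yields all
  transpositions, and these generate all permutations.\<close>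

lemma FS_complete_linked:
  assumes "pair_graph X" "pair_graph Y" "linked Y"
    and complete: "\<And>a b. a \<in> pverts X \<Longrightarrow> b \<in> pverts X \<Longrightarrow> a \<noteq> b \<Longrightarrow> (a, b) \<in> parcs X"
  shows "linked (FS X Y)"
proof -
  interpret Y: pair_graph Y by fact
  let ?c = "compose (pverts X)" and ?R = "(parcs (FS X Y))\<^sup>*"
  have compose_id: "?c id \<sigma> = \<sigma>" if "\<sigma> \<in> pverts (FS X Y)" for \<sigma>
    using that by (auto simp: pverts_FS compose_def extensional_def)
  have comp: "?c p (?c q \<sigma>) = ?c (p \<circ> q) \<sigma>" for p q \<sigma>
    by (auto simp: compose_def)
  have edge: "(\<sigma>, ?c (transpose y z) \<sigma>) \<in> ?R"
    if "(y, z) \<in> parcs Y" "\<sigma> \<in> pverts (FS X Y)" for y z \<sigma>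
  proof -
    have bij: "bij_betw \<sigma> (pverts X) (pverts Y)" using that(2) by (simp add: pverts_FS)
    have "y \<in> pverts Y" "z \<in> pverts Y" "y \<noteq> z"
      using that(1) Y.arc_fst_in_verts Y.arc_snd_in_verts Y.pair_no_loops by force+
    then obtain a b where "a \<in> pverts X" "b \<in> pverts X" "\<sigma> a = y" "\<sigma> b = z" "a \<noteq> b"
      using bij unfolding bij_betw_def by (metis imageE)
    with FS_swap[OF assms(1) that(2) complete] that(1) show ?thesis by blast
  qed
  \<comment> \<open>The statement ranges over all states because the induction hypothesis is applied
    twice: at \<sigma> and again after the swap of \<open>y\<close> and \<open>z\<close>.\<close>
  have trans: "\<forall>\<sigma> \<in> pverts (FS X Y). (\<sigma>, ?c (transpose u v) \<sigma>) \<in> ?R"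
    if "(u, v) \<in> (parcs Y)\<^sup>*" "u \<in> pverts Y" for u v
    using that(1)
  proof induction
    case base
    show ?case by (simp add: compose_id[unfolded id_def])
  next
    case (step y z)
    have yz: "y \<in> pverts Y" "z \<in> pverts Y" "y \<noteq> z"
      using step.hyps(2) Y.arc_fst_in_verts Y.arc_snd_in_verts Y.pair_no_loops by force+
    show ?case
    proof
      fix \<sigma> assume s: "\<sigma> \<in> pverts (FS X Y)"
      show "(\<sigma>, ?c (transpose u z) \<sigma>) \<in> ?R"
      \<comment> \<open>A walk may return to its start, where the conjugation identity fails but the
        transposition is the identity.\<close>
      proof (cases "u = z")
        case True
        then show ?thesis using compose_id[OF s] by (simp add: id_def)
      next
        case False
        let ?s = "?c (transpose u y) \<sigma>" let ?t = "?c (transpose y z) ?s"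
        have s': "?s \<in> pverts (FS X Y)"
          using FS_compose[OF s permutes_swap_id[OF that(2) yz(1)]] .
        then have t': "?t \<in> pverts (FS X Y)"
          using FS_compose[OF _ permutes_swap_id[OF yz(1,2)]] by blast
        have "(\<sigma>, ?s) \<in> ?R" using step.IH s by blast
        also have "(?s, ?t) \<in> ?R" using edge step.hyps(2) s' by blast
        also have "(?t, ?c (transpose u y) ?t) \<in> ?R" using step.IH t' by blast
        also have "?c (transpose u y) ?t = ?c (transpose u z) \<sigma>"
          using transpose_conj[OF False yz(3)] by (simp add: comp o_assoc)
        finally show ?thesis .
      qed
    qed
  qed
  have perm: "\<forall>\<sigma> \<in> pverts (FS X Y). (\<sigma>, ?c p \<sigma>) \<in> ?R" if "p permutes pverts Y" for p
    using that Y.pair_finite_verts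
  proof (induction rule: permutes_induct)
    case id
    show ?case by (simp add: compose_id[unfolded id_def])
  next
    case (swap a b p)
    show ?case
    proof
      fix \<sigma> assume s: "\<sigma> \<in> pverts (FS X Y)"
      then have "(\<sigma>, ?c p \<sigma>) \<in> ?R" using swap by blast
      also have "(?c p \<sigma>, ?c (transpose a b) (?c p \<sigma>)) \<in> ?R"
        using trans[of a b] assms(3) swap FS_compose[OF s] by (auto simp: linked_def)
      finally show "(\<sigma>, ?c (transpose a b \<circ> p) \<sigma>) \<in> ?R" by (simp add: comp)
    qed
  qed
  show ?thesis
    unfolding linked_def
  proof (intro ballI)
    fix \<sigma> \<tau> assume s: "\<sigma> \<in> pverts (FS X Y)" and t: "\<tau> \<in> pverts (FS X Y)"
    \<comment> \<open>The relabelling of occupants that carries \<sigma> to \<tau>; \<open>p\<close>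
      extends it by the identity outside \<open>pverts Y\<close>, as \<open>permutes\<close>
      demands.\<close>
    define q where "q = \<tau> \<circ> inv_into (pverts X) \<sigma>"
    define p where "p = (\<lambda>y. if y \<in> pverts Y then q y else y)"
    have bs: "bij_betw \<sigma> (pverts X) (pverts Y)" and bt: "bij_betw \<tau> (pverts X) (pverts Y)"
      using s t by (auto simp: pverts_FS)
    have "bij_betw q (pverts Y) (pverts Y)"
      unfolding q_def using bij_betw_inv_into[OF bs] bt by (rule bij_betw_trans)
    then have "bij_betw p (pverts Y) (pverts Y)"
      by (subst bij_betw_cong[of _ _ q]) (auto simp: p_def)
    then have "p permutes pverts Y"
      by (rule bij_imp_permutes) (simp add: p_def)
    moreover have "?c p \<sigma> = \<tau>"
    proof
      fix x show "?c p \<sigma> x = \<tau> x"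
        using bs t by (auto simp: compose_def p_def q_def pverts_FS extensional_def
            bij_betw_def inv_into_f_f)
    qed
    ultimately show "(\<sigma>, \<tau>) \<in> ?R" using perm s by metis
  qed
qed

section \<open>Sufficiency\<close>

lemma FS_peel_linked:
  assumes X: "pair_graph X" and Y: "pair_graph Y" "linked Y"
    and x01: "(x0, x1) \<in> parcs X"
    and IH: "\<And>y. y \<in> pverts Y \<Longrightarrow>
      linked (FS (pair_induce X (pverts X - {x0})) (pair_induce Y (pverts Y - {y})))"
  shows "linked (FS X Y)"
proof -
  interpret X: pair_graph X by fact
  interpret Y: pair_graph Y by fact
  let ?R = "(parcs (FS X Y))\<^sup>*"
  let ?V = "pverts X - {x0}"
  have x: "x0 \<in> pverts X" "x1 \<in> pverts X" "x0 \<noteq> x1"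
    using x01 X.arc_fst_in_verts X.arc_snd_in_verts X.pair_no_loops by force+
  \<comment> \<open>States with the same occupant \<open>y\<close> of \<open>x0\<close> correspond
    to states of the smaller graph, by restricting and by putting \<open>y\<close> back. Moves there
    avoid both \<open>x0\<close> and \<open>y\<close>, hence remain moves in the large
    graph.\<close>
  have lift: "(\<sigma>, \<tau>) \<in> ?R"
    if s: "\<sigma> \<in> pverts (FS X Y)" and t: "\<tau> \<in> pverts (FS X Y)" and eq: "\<sigma> x0 = \<tau> x0" for \<sigma> \<tau>
  proof -
    define y where "y = \<sigma> x0"
    let ?F = "FS (pair_induce X ?V) (pair_induce Y (pverts Y - {y}))"
    have y: "y \<in> pverts Y" using s x by (auto simp: pverts_FS bij_betw_def y_def)
    have small: "restrict \<rho> ?V \<in> pverts ?F \<and> (restrict \<rho> ?V)(x0 := y) = \<rho>"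
      if r: "\<rho> \<in> pverts (FS X Y)" "\<rho> x0 = y" for \<rho>
    proof
      have "bij_betw \<rho> (pverts X - {x0}) (pverts Y - {y})"
        using r x by (intro bij_betw_DiffI) (auto simp: pverts_FS y)
      then have "bij_betw (restrict \<rho> ?V) ?V (pverts Y - {y})"
        by (subst bij_betw_cong[of _ _ \<rho>]) auto
      then show "restrict \<rho> ?V \<in> pverts ?F" by (simp add: pverts_FS)
      show "(restrict \<rho> ?V)(x0 := y) = \<rho>"
        using r by (auto simp: pverts_FS extensional_def fun_eq_iff)
    qed
    have big: "f(x0 := y) \<in> pverts (FS X Y)" if "f \<in> pverts ?F" for f
    proof -
      have "bij_betw (f(x0 := y)) ?V (pverts Y - {y})"
        using that by (subst bij_betw_cong[of _ _ f]) (auto simp: pverts_FS)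
      then have "bij_betw (f(x0 := y)) (?V \<union> {x0}) (pverts Y - {y} \<union> {y})"
        by (rule bij_betw_combine) auto
      then show ?thesis
        using that x y by (auto simp: pverts_FS extensional_def insert_absorb)
    qed
    have "(f(x0 := y), g(x0 := y)) \<in> parcs (FS X Y)" if fg: "(f, g) \<in> parcs ?F" for f g
    proof -
      from fg obtain a b where ab: "f \<in> pverts ?F" "g \<in> pverts ?F"
        "(a, b) \<in> parcs X" "a \<in> ?V" "b \<in> ?V" "(f a, f b) \<in> parcs Y"
        "f a = g b" "f b = g a" "\<forall>c \<in> ?V - {a, b}. f c = g c"
        unfolding parcs_FS by auto
      show ?thesis
        unfolding parcs_FS using ab big
        by (intro conjI exI[of _ a] exI[of _ b]) auto
    qed
    moreover have "(restrict \<sigma> ?V, restrict \<tau> ?V) \<in> (parcs ?F)\<^sup>*"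
      using IH[OF y] small s t eq by (auto simp: linked_def y_def)
    ultimately have "((restrict \<sigma> ?V)(x0 := y), (restrict \<tau> ?V)(x0 := y)) \<in> ?R"
      by (rule rtrancl_image[rotated])
    then show ?thesis using small[OF s y_def[symmetric]] small[OF t] eq by (metis y_def)
  qed
  have move: "\<exists>\<sigma>' \<in> pverts (FS X Y). (\<sigma>, \<sigma>') \<in> ?R \<and> \<sigma>' x0 = w"
    if s: "\<sigma> \<in> pverts (FS X Y)" and w: "(\<sigma> x0, w) \<in> parcs Y" for \<sigma> w
  proof -
    have inj: "inj_on \<sigma> (pverts X)" and mem: "\<sigma> x1 \<in> pverts Y"
      using s x by (auto simp: pverts_FS bij_betw_def)
    have "w \<in> pverts Y" "w \<noteq> \<sigma> x0" "\<sigma> x1 \<noteq> \<sigma> x0"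
      using w x inj Y.arc_snd_in_verts Y.pair_no_loops by (force simp: inj_on_eq_iff)+
    note w' = this
    \<comment> \<open>\<rho> brings \<open>w\<close> to \<open>x1\<close>. The transposition fixes
      the occupant of \<open>x0\<close>, so \<rho> is reachable by \<open>lift\<close>; one move
      along the edge from \<open>x0\<close> to \<open>x1\<close> then puts \<open>w\<close> on
      \<open>x0\<close>.\<close>
    define \<rho> where "\<rho> = compose (pverts X) (transpose (\<sigma> x1) w) \<sigma>"
    have r: "\<rho> \<in> pverts (FS X Y)"
      unfolding \<rho>_def using FS_compose[OF s permutes_swap_id[OF mem w'(1)]] .
    have r': "\<rho> x0 = \<sigma> x0" "\<rho> x1 = w"
      using x w' by (auto simp: \<rho>_def compose_def transpose_def)
    let ?t = "compose (pverts X) (transpose (\<rho> x0) (\<rho> x1)) \<rho>"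
    have "(\<sigma>, \<rho>) \<in> ?R" using lift[OF s r] r' by simp
    moreover have arc: "(\<rho>, ?t) \<in> parcs (FS X Y)"
      using FS_swap[OF X r x01] r' w by simp
    moreover have "?t x0 = w" using x r' by (simp add: compose_def)
    moreover have "?t \<in> pverts (FS X Y)" using arc by (simp add: parcs_FS)
    ultimately show ?thesis by (blast intro: rtrancl_into_rtrancl)
  qed
  have walk: "\<exists>\<sigma>' \<in> pverts (FS X Y). (\<sigma>, \<sigma>') \<in> ?R \<and> \<sigma>' x0 = v"
    if s: "\<sigma> \<in> pverts (FS X Y)" and v: "(\<sigma> x0, v) \<in> (parcs Y)\<^sup>*" for \<sigma> v
    using v
  proof induction
    case base
    show ?case using s by blast
  next
    case (step y z)
    then obtain \<sigma>' where s': "\<sigma>' \<in> pverts (FS X Y)" "(\<sigma>, \<sigma>') \<in> ?R" "\<sigma>' x0 = y" by blast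
    with move[OF s'(1)] step.hyps(2) obtain \<sigma>'' where
      "\<sigma>'' \<in> pverts (FS X Y)" "(\<sigma>', \<sigma>'') \<in> ?R" "\<sigma>'' x0 = z" by blast
    with s'(2) show ?case using rtrancl_trans by fast
  qed
  show ?thesis
    unfolding linked_def
  proof (intro ballI)
    fix \<sigma> \<tau> assume s: "\<sigma> \<in> pverts (FS X Y)" and t: "\<tau> \<in> pverts (FS X Y)"
    have "\<sigma> x0 \<in> pverts Y" "\<tau> x0 \<in> pverts Y"
      using s t x by (auto simp: pverts_FS bij_betw_def)
    then obtain \<sigma>' where "\<sigma>' \<in> pverts (FS X Y)" "(\<sigma>, \<sigma>') \<in> ?R" "\<sigma>' x0 = \<tau> x0"
      using walk[OF s] Y(2) unfolding linked_def by blast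
    then show "(\<sigma>, \<tau>) \<in> ?R" using lift t by (meson rtrancl_trans)
  qed
qed

section \<open>Induction along the path of the lollipop\<close>

lemma pverts_lollipop: "pverts (lollipop m k) = {1..m + k}"
  by (simp add: lollipop_def Let_def)

lemma parcs_lollipop:
  "(a, b) \<in> parcs (lollipop m k) \<longleftrightarrow>
    (b = a + 1 \<and> 1 \<le> a \<and> a \<le> m) \<or> (a = b + 1 \<and> 1 \<le> b \<and> b \<le> m) \<or>
    (m < a \<and> m < b \<and> a \<noteq> b \<and> a \<le> m + k \<and> b \<le> m + k)"
  by (auto simp: lollipop_def Let_def)

text \<open>As \<open>k\<close> is at least 2, any two vertices lie in a common subset of size
  \<open>k\<close>, whose walks are walks in \<open>B\<close>. This supplies the connectedness
  needed at each peeling.\<close>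

lemma linked_if_k_subsets_linked:
  assumes "2 \<le> k" "finite B" "k \<le> card B"
    and "\<And>C. C \<subseteq> B \<Longrightarrow> card C = k \<Longrightarrow> linked (pair_induce Y C)"
  shows "linked (pair_induce Y B)"
  unfolding linked_def
proof (intro ballI)
  fix u v assume "u \<in> pverts (pair_induce Y B)" "v \<in> pverts (pair_induce Y B)"
  then have uv: "{u, v} \<subseteq> B" by simp
  have "card {u, v} \<le> k"
    using assms(1) card_insert_le_m1[of k "{v}" u] by simp
  then obtain C where C: "{u, v} \<subseteq> C" "C \<subseteq> B" "card C = k"
    using exists_subset_between[OF _ assms(3) uv assms(2)] by blast
  then have "(u, v) \<in> (parcs (pair_induce Y C))\<^sup>*"
    using assms(4) by (auto simp: linked_def)
  moreover have "parcs (pair_induce Y C) \<subseteq> parcs (pair_induce Y B)" using C by auto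
  ultimately show "(u, v) \<in> (parcs (pair_induce Y B))\<^sup>*" using rtrancl_mono by blast
qed

text \<open>\<open>d\<close> counts the path vertices still present outside the clique, and
  \<open>B\<close> holds the occupants still to be placed. \<open>B\<close> is arbitrary because
  each peeling removes an arbitrary occupant; the hypothesis on subsets of size \<open>k\<close> is
  inherited.\<close>

lemma FS_lollipop_linked:
  assumes Y: "pair_graph Y" and k: "2 \<le> k"
    and sub: "\<And>C. C \<subseteq> pverts Y \<Longrightarrow> card C = k \<Longrightarrow> linked (pair_induce Y C)"
    and "d \<le> m" "B \<subseteq> pverts Y" "card B = k + d"
  shows "linked (FS (pair_induce (lollipop m k) {m - d + 1..m + k}) (pair_induce Y B))"
  using assms(4-)
proof (induction d arbitrary: B)
  case 0
  show ?case
  proof (rule FS_complete_linked)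
    show "pair_graph (pair_induce (lollipop m k) {m - 0 + 1..m + k})"
      using k by (intro pair_graph_pair_induce pair_graph_lollipop) (auto simp: pverts_lollipop)
    show "pair_graph (pair_induce Y B)"
      using Y 0 by (intro pair_graph_pair_induce)
  qed (use 0 sub in \<open>auto simp: parcs_lollipop\<close>)
next
  case (Suc d)
  \<comment> \<open>The free end of the remaining path: it equals \<open>m - Suc d + 1\<close> since
    \<open>Suc d\<close> \<le> \<open>m\<close>.\<close>
  let ?x = "m - d"
  have fin: "finite B"
    using Suc.prems(2) pair_fin_digraph.pair_finite_verts Y
    by (metis card.infinite add_is_0 Suc.prems(3) k not_numeral_le_zero)
  have V: "{m - Suc d + 1..m + k} = insert ?x {m - d + 1..m + k}" "?x \<ge> 1"
    using Suc.prems(1) k by auto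
  show ?case
  proof (rule FS_peel_linked[where ?x0.0 = ?x and ?x1.0 = "?x + 1"])
    show "pair_graph (pair_induce (lollipop m k) {m - Suc d + 1..m + k})"
      using k by (intro pair_graph_pair_induce pair_graph_lollipop) (auto simp: pverts_lollipop)
    show "pair_graph (pair_induce Y B)"
      using Y Suc by (intro pair_graph_pair_induce)
    show "linked (pair_induce Y B)"
    proof (rule linked_if_k_subsets_linked[OF k fin])
      show "k \<le> card B" using Suc.prems(3) by simp
      show "linked (pair_induce Y C)" if "C \<subseteq> B" "card C = k" for C
        using sub that Suc.prems(2) by blast
    qed
    show "(?x, ?x + 1) \<in> parcs (pair_induce (lollipop m k) {m - Suc d + 1..m + k})"
      using Suc.prems k by (auto simp: parcs_lollipop)
    fix y assume "y \<in> pverts (pair_induce Y B)"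
    then have "linked (FS (pair_induce (lollipop m k) {m - d + 1..m + k})
        (pair_induce Y (B - {y})))"
      using Suc.prems fin by (intro Suc.IH) auto
    moreover have "{m - Suc d + 1..m + k} - {?x} = {m - d + 1..m + k}"
      unfolding V by auto
    ultimately show "linked (FS
        (pair_induce (pair_induce (lollipop m k) {m - Suc d + 1..m + k})
          (pverts (pair_induce (lollipop m k) {m - Suc d + 1..m + k}) - {?x}))
        (pair_induce (pair_induce Y B) (pverts (pair_induce Y B) - {y})))"
      by (simp add: pair_induce_pair_induce V(1) subset_insertI del: One_nat_def)
  qed
qed

section \<open>Necessity\<close>

text \<open>The invariant of the necessity proof. It is applied with \<open>C\<close> a component of
  the subgraph induced on \<open>A\<close>, where it says that the leftmost member of
  \<open>A\<close> belongs to this component.\<close>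

definition leftmost_in :: "nat set \<Rightarrow> 'a set \<Rightarrow> 'a set \<Rightarrow> (nat \<Rightarrow> 'a) \<Rightarrow> bool" where
  "leftmost_in V A C \<sigma> \<longleftrightarrow> (\<exists>p \<in> V. \<sigma> p \<in> C \<and> (\<forall>q \<in> V. q < p \<longrightarrow> \<sigma> q \<notin> A))"

text \<open>The \<open>k\<close> positions occupied by \<open>A\<close> all lie in
  \<open>{p..m + k}\<close>. Counting bounds \<open>p\<close>, and in the extreme case the interval
  has exactly \<open>k\<close> elements and is filled.\<close>

lemma leftmost_position:
  assumes "bij_betw \<sigma> {1..m + k} W" "A \<subseteq> W" "card A = k"
    and "p \<in> {1..m + k}" "\<forall>q \<in> {1..m + k}. q < p \<longrightarrow> \<sigma> q \<notin> A"
  shows "p \<le> m + 1" and "p = m + 1 \<Longrightarrow> q \<in> {m + 1..m + k} \<Longrightarrow> \<sigma> q \<in> A"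
proof -
  let ?P = "{q \<in> {1..m + k}. \<sigma> q \<in> A}"
  have "\<sigma> ` ?P = A" using assms(1,2) by (auto simp: bij_betw_def)
  moreover have "inj_on \<sigma> ?P"
    using bij_betw_imp_inj_on[OF assms(1)] by (rule inj_on_subset) blast
  ultimately have cP: "card ?P = k" using card_image[of \<sigma> ?P] assms(3) by simp
  have sub: "?P \<subseteq> {p..m + k}" using assms(5) by (force simp: not_less)
  have "k \<le> card {p..m + k}" using card_mono[OF _ sub] cP by simp
  then show "p \<le> m + 1" using assms(4) by auto
  show "\<sigma> q \<in> A" if "p = m + 1" "q \<in> {m + 1..m + k}"
  proof -
    have "?P = {p..m + k}"
      by (rule card_subset_eq[OF _ sub]) (use that cP in auto)
    then show ?thesis using that by blast
  qed
qed

text \<open>Only a swap with another member of \<open>A\<close> can replace the leftmost member, and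
  closure of \<open>C\<close> keeps the new one in \<open>C\<close>. Otherwise that member just
  changes position or stays, and no other member of \<open>A\<close> can get in front of it.\<close>

lemma leftmost_in_step:
  assumes st: "(\<sigma>, \<tau>) \<in> parcs (FS (lollipop m k) Y)"
    and A: "A \<subseteq> pverts Y" "card A = k" "k \<ge> 1"
    and C: "C \<subseteq> A" "\<And>u v. u \<in> C \<Longrightarrow> v \<in> A \<Longrightarrow> (u, v) \<in> parcs Y \<Longrightarrow> v \<in> C"
    and sym: "\<And>u v. (u, v) \<in> parcs Y \<Longrightarrow> (v, u) \<in> parcs Y"
    and "leftmost_in {1..m + k} A C \<sigma>"
  shows "leftmost_in {1..m + k} A C \<tau>"
proof -
  have bij: "bij_betw \<sigma> {1..m + k} (pverts Y)"
    using st by (auto simp: parcs_FS pverts_FS pverts_lollipop)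
  obtain p where p: "p \<in> {1..m + k}" "\<sigma> p \<in> C" "\<forall>q \<in> {1..m + k}. q < p \<longrightarrow> \<sigma> q \<notin> A"
    using assms(8) unfolding leftmost_in_def by blast
  note pos = leftmost_position[OF bij A(1,2) p(1,3)]
  obtain a b where ab: "(a, b) \<in> parcs (lollipop m k)" "(\<sigma> a, \<sigma> b) \<in> parcs Y"
    "\<tau> a = \<sigma> b" "\<tau> b = \<sigma> a" "\<And>c. c \<in> {1..m + k} \<Longrightarrow> c \<notin> {a, b} \<Longrightarrow> \<tau> c = \<sigma> c" "a < b"
  proof -
    from st obtain a b where ab: "(a, b) \<in> parcs (lollipop m k)" "(\<sigma> a, \<sigma> b) \<in> parcs Y"
      "\<sigma> a = \<tau> b" "\<sigma> b = \<tau> a" "\<forall>c \<in> {1..m + k} - {a, b}. \<sigma> c = \<tau> c"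
      unfolding parcs_FS pverts_lollipop by blast
    have "a \<noteq> b" using ab(1) by (auto simp: parcs_lollipop)
    then consider "a < b" | "b < a" by linarith
    then show thesis
    proof cases
      case 1
      with ab show thesis by (intro that[of a b]) simp_all
    next
      case 2
      have "(b, a) \<in> parcs (lollipop m k)" using ab(1) by (auto simp: parcs_lollipop)
      with 2 ab sym[OF ab(2)] show thesis by (intro that[of b a]) simp_all
    qed
  qed
  have V: "a \<in> {1..m + k}" "b \<in> {1..m + k}" using ab(1,6) A(3) by (auto simp: parcs_lollipop)
  have adj: "b = a + 1 \<or> m < a" using ab(1,6) by (auto simp: parcs_lollipop)
  \<comment> \<open>Here \<open>p\<close> is the leftmost position of \<open>A\<close>, and the
    swapped positions satisfy \<open>a < b\<close>. A swap across \<open>p\<close> would need two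
    clique vertices with \<open>m < a < p\<close>, against \<open>p\<close> \<le>
    \<open>m + 1\<close>.\<close>
  consider "p < a" | "p = a" | "p = b" | "a < p" "p < b" | "b < p" by linarith
  then show ?thesis
  proof cases
    case 1
    then have "\<tau> p \<in> C" "\<forall>q \<in> {1..m + k}. q < p \<longrightarrow> \<tau> q \<notin> A"
      using p ab by auto
    then show ?thesis using p(1) by (auto simp: leftmost_in_def)
  next
    case 2
    show ?thesis
    proof (cases "\<sigma> b \<in> A")
      case True
      then have "\<tau> p \<in> C" "\<forall>q \<in> {1..m + k}. q < p \<longrightarrow> \<tau> q \<notin> A"
        using p ab C 2 by auto
      then show ?thesis using p(1) by (auto simp: leftmost_in_def)
    next
      case False
      have "b = a + 1"
      \<comment> \<open>A longer edge lies inside the clique, which forces \<open>p = m + 1\<close>.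
        Then \<open>A\<close> fills the clique, so it would contain the occupant of
        \<open>b\<close>.\<close>
      proof (rule ccontr)
        assume "b \<noteq> a + 1"
        then have "p = m + 1" using adj pos(1) 2 by simp
        then show False using pos(2)[of b] False ab(6) V 2 by auto
      qed
      moreover have "\<tau> b \<in> C" using ab 2 p by simp
      moreover have "\<tau> q \<notin> A" if "q \<in> {1..m + k}" "q < b" for q
        using that False p ab 2 calculation(1) by (cases "q = a") auto
      ultimately show ?thesis using V by (auto simp: leftmost_in_def)
    qed
  next
    case 3
    have "\<tau> a \<in> C" "\<forall>q \<in> {1..m + k}. q < a \<longrightarrow> \<tau> q \<notin> A"
      using p ab 3 by auto
    then show ?thesis using V by (auto simp: leftmost_in_def)
  next
    case 4
    then show ?thesis using adj pos(1) by auto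
  next
    case 5
    have "\<tau> q \<notin> A" if "q \<in> {1..m + k}" "q < p" for q
      using that p ab V 5 by (cases "q = a"; cases "q = b") auto
    moreover have "\<tau> p \<in> C" using ab p 5 by auto
    ultimately show ?thesis using p(1) by (auto simp: leftmost_in_def)
  qed
qed

text \<open>Take a state with \<open>u\<close> on position 1 and one with \<open>v\<close> there.
  Each of these vertices is then the leftmost member of \<open>A\<close>, so the invariant, carried
  from the first state to the second, puts \<open>v\<close> in the component of
  \<open>u\<close>.\<close>

lemma k_subset_linked_if_FS_lollipop_linked:
  assumes Y: "pair_graph Y" "card (pverts Y) = m + k"
    and FS: "linked (FS (lollipop m k) Y)"
    and A: "A \<subseteq> pverts Y" "card A = k"
  shows "linked (pair_induce Y A)"
  unfolding linked_def
proof (intro ballI)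
  fix u v assume "u \<in> pverts (pair_induce Y A)" "v \<in> pverts (pair_induce Y A)"
  then have uv: "u \<in> A" "v \<in> A" by auto
  interpret Y: pair_graph Y by fact
  have "finite A" using A(1) Y.pair_finite_verts by (rule finite_subset)
  then have k: "k \<ge> 1" using uv A by (auto simp: Suc_le_eq card_gt_0_iff)
  let ?E = "parcs (pair_induce Y A)"
  define C where "C = {w. (u, w) \<in> ?E\<^sup>*}"
  have "w \<in> A" if "(u, w) \<in> ?E\<^sup>*" for w
    using that by cases (use uv in auto)
  then have CA: "C \<subseteq> A" by (auto simp: C_def)
  have closed: "y \<in> C" if "x \<in> C" "y \<in> A" "(x, y) \<in> parcs Y" for x y
  proof -
    have "(x, y) \<in> ?E" using that CA by auto
    with that(1) show ?thesis unfolding C_def by (auto intro: rtrancl_into_rtrancl)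
  qed
  have ex: "\<exists>\<sigma> \<in> pverts (FS (lollipop m k) Y). \<sigma> 1 = y" if "y \<in> A" for y
    using FS_exists[of "lollipop m k" Y 1 y] that A Y k Y.pair_finite_verts
    by (auto simp: pverts_lollipop)
  obtain \<sigma> \<tau> where s: "\<sigma> \<in> pverts (FS (lollipop m k) Y)" "\<sigma> 1 = u"
    and t: "\<tau> \<in> pverts (FS (lollipop m k) Y)" "\<tau> 1 = v"
    using ex uv by blast
  have "(\<sigma>, \<tau>) \<in> (parcs (FS (lollipop m k) Y))\<^sup>*" using FS s t by (auto simp: linked_def)
  then have "leftmost_in {1..m + k} A C \<tau>"
  proof induction
    case base
    have "u \<in> C" by (simp add: C_def)
    then show ?case unfolding leftmost_in_def using s k by (intro bexI[of _ 1]) auto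
  next
    case (step y z)
    then show ?case
      using leftmost_in_step A k CA closed pair_graph_symD[OF Y(1)] by metis
  qed
  then obtain p where p: "p \<in> {1..m + k}" "\<tau> p \<in> C" "\<forall>q \<in> {1..m + k}. q < p \<longrightarrow> \<tau> q \<notin> A"
    by (auto simp: leftmost_in_def)
  \<comment> \<open>Position 1 holds \<open>v\<close>, a member of \<open>A\<close>, so no later
    position can be the leftmost one.\<close>
  have "p = 1" using p t uv k by (cases "p = 1") auto
  then show "(u, v) \<in> ?E\<^sup>*" using p t by (simp add: C_def)
qed

section \<open>Translation to vertex sets and the equivalences\<close>

lemma induced_subgraph_with_proj_iff:
  assumes "pair_graph Y"
  shows "induced_subgraph H (with_proj Y) \<longleftrightarrow>
    (\<exists>A \<subseteq> pverts Y. H = with_proj (pair_induce Y A))"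
proof
  interpret Y: pair_graph Y by fact
  show "induced_subgraph H (with_proj Y)" if "\<exists>A \<subseteq> pverts Y. H = with_proj (pair_induce Y A)"
    using that Y.induced_induce by (auto simp: with_proj_pair_induce)
  assume H: "induced_subgraph H (with_proj Y)"
  then have "H = with_proj (pair_induce Y (verts H))" "verts H \<subseteq> pverts Y"
    by (auto simp: induced_subgraph_def subgraph_def compatible_def with_proj_pair_induce
        induce_subgraph_def intro!: pre_digraph.equality)
  then show "\<exists>A \<subseteq> pverts Y. H = with_proj (pair_induce Y A)" by blast
qed

theorem theorem1p6:
  fixes n k :: nat and Y :: "'a pair_pre_digraph"
  assumes "2 \<le> k" and "k \<le> n"
    and "pair_graph Y" and "card (pverts Y) = n"
  shows "(Digraph_Component.connected (with_proj (FS (lollipop (n - k) k) Y)) \<longleftrightarrow>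
            (\<forall>H. induced_subgraph H (with_proj Y) \<and> card (verts H) = k \<longrightarrow>
               Digraph_Component.connected H)) \<and>
         ((\<forall>H. induced_subgraph H (with_proj Y) \<and> card (verts H) = k \<longrightarrow>
               Digraph_Component.connected H) \<longleftrightarrow>
            vertex_connected (n - k + 1) Y)"
proof -
  interpret Y: pair_graph Y by fact
  define m where "m = n - k"
  have n: "n = m + k" using assms(2) by (simp add: m_def)
  let ?X = "lollipop m k"
  have X: "pair_graph ?X" using assms(1) by (intro pair_graph_lollipop) simp
  have conn: "Digraph_Component.connected (with_proj (pair_induce Y A)) \<longleftrightarrow>
      linked (pair_induce Y A)" if "A \<subseteq> pverts Y" "card A = k" for A
    using connected_iff_linked[OF pair_graph_pair_induce[OF assms(3) that(1)]] that(2) assms(1)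
    by auto
  have ii: "(\<forall>H. induced_subgraph H (with_proj Y) \<and> card (verts H) = k \<longrightarrow>
      Digraph_Component.connected H) \<longleftrightarrow>
      (\<forall>A \<subseteq> pverts Y. card A = k \<longrightarrow> linked (pair_induce Y A))" (is "?ii \<longleftrightarrow> ?ii'")
  proof -
    have "?ii \<longleftrightarrow> (\<forall>A. A \<subseteq> pverts Y \<and> card (verts (with_proj (pair_induce Y A))) = k \<longrightarrow>
        Digraph_Component.connected (with_proj (pair_induce Y A)))"
      unfolding induced_subgraph_with_proj_iff[OF assms(3)] by blast
    then show ?thesis using conn by auto
  qed
  \<comment> \<open>Complementation matches the sets of \<open>m\<close> removed vertices with the
    sets of \<open>k\<close> remaining ones.\<close>
  have iii: "?ii' \<longleftrightarrow> vertex_connected (m + 1) Y"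
  proof -
    have card_diff: "card (pverts Y - S) = n - card S" if "S \<subseteq> pverts Y" for S
      using that Y.pair_finite_verts assms(4) by (metis card_Diff_subset finite_subset)
    show ?thesis
    proof
      assume L: ?ii'
      show "vertex_connected (m + 1) Y"
        unfolding vertex_connected_def
      proof (intro allI impI)
        fix S assume S: "S \<subseteq> pverts Y" "card S = m + 1 - 1"
        have c: "card (pverts Y - S) = k" using card_diff[OF S(1)] S(2) n by simp
        then have "linked (pair_induce Y (pverts Y - S))" using L by blast
        then show "Digraph_Component.connected (with_proj Y \<restriction> (pverts Y - S))"
          using conn[OF _ c] by (auto simp: with_proj_pair_induce)
      qed
    next
      assume R: "vertex_connected (m + 1) Y"
      show ?ii'
      proof (intro allI impI)
        fix A assume A: "A \<subseteq> pverts Y" "card A = k"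
        have "card (pverts Y - A) = m" using card_diff[OF A(1)] A(2) n by simp
        then have "Digraph_Component.connected (with_proj Y \<restriction> (pverts Y - (pverts Y - A)))"
          using R unfolding vertex_connected_def by auto
        moreover have "pverts Y - (pverts Y - A) = A" using A by auto
        ultimately show "linked (pair_induce Y A)"
          using conn[OF A] by (simp add: with_proj_pair_induce)
      qed
    qed
  qed
  \<comment> \<open>\<open>connected\<close> requires a vertex, so some bijection has to be
    exhibited before it can be replaced by \<open>linked\<close>.\<close>
  have "pverts Y \<noteq> {}" using assms by auto
  then obtain y where "y \<in> pverts Y" by blast
  then have nonempty: "pverts (FS ?X Y) \<noteq> {}"
    using FS_exists[of ?X Y 1 y] Y.pair_finite_verts assms(1,4) n
    by (auto simp: pverts_lollipop)
  have i: "linked (FS ?X Y) \<longleftrightarrow> ?ii'"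
  proof
    assume "linked (FS ?X Y)"
    then show ?ii'
      using k_subset_linked_if_FS_lollipop_linked[OF assms(3)] assms(4) n by blast
  next
    assume L: ?ii'
    \<comment> \<open>The instance \<open>d = m\<close>: the positions are all of
      \<open>{1..m + k}\<close>, and \<open>B\<close> is the whole of
      \<open>pverts Y\<close>.\<close>
    have "linked (FS (pair_induce ?X {m - m + 1..m + k}) (pair_induce Y (pverts Y)))"
      by (rule FS_lollipop_linked) (use assms n L in auto)
    moreover have "pair_induce ?X {m - m + 1..m + k} = ?X"
      using assms(1) by (auto simp: pair_induce_def parcs_lollipop pverts_lollipop
          intro!: pair_pre_digraph.equality)
    moreover have "pair_induce Y (pverts Y) = Y"
      using Y.arc_fst_in_verts Y.arc_snd_in_verts
      by (force simp: pair_induce_def intro!: pair_pre_digraph.equality)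
    ultimately show "linked (FS ?X Y)" by simp
  qed
  show ?thesis
    using i ii iii nonempty connected_iff_linked[OF pair_graph_FS[OF X assms(3)]]
    by (simp add: m_def)
qed

end
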